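(* Let $k,r\ge2$ be integers and let $\Gamma$ be the symmetric graph of type $k$ and order $r$ with vertex set $\mathcal V$. Let $U:\mathcal V\times\mathcal V\to\mathbb C$ be a function such that $$\mathcal L^{\Gamma}_xU(x,y)=\mathcal L^{\Gamma}_yU(x,y)\qquad\forall\,x,y\in\mathcal V.$$ Then $$\sum_{x'\in S(x,m)}\ \sum_{y'\in S(y,n)}U(x',y')=\sum_{x'\in S(x,n)}\ \sum_{y'\in S(y,m)}U(x',y')$$ for all $x,y\in\mathcal V$ and $m,n\in\mathbb N$. In particular $$\sum_{x'\in S(x,n)}U(x',y)=\sum_{y'\in S(y,n)}U(x,y').$$
   Context: Symmetric graph: $\Gamma$ is a connected graph in which every vertex $v$ belongs to exactly $r$ polygons with $k$ sides each (for $k=2$ a polygon is a single edge), these polygons having no side and no vertex in common except $v$, and such that every nontrivial loop runs through all the edges of at least one polygon. $\mathcal V$ is its vertex set. The distance $d(x,y)$ is the minimal number of polygons crossed by a path connecting $x$ with $y$, and $S(x,n)=\{y\in\mathcal V:d(x,y)=n\}$. The Laplacian on $\Gamma$ is $$\mathcal L^{\Gamma}f(x)=f(x)-\frac1{r(k-1)}\sum_{y:\,d(x,y)=1}f(y);$$ $\mathcal L^\Gamma_x$, $\mathcal L^\Gamma_y$ denote this operator acting in the variable $x$, respectively $y$. *)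

theory Defs
  imports Complex_Main "HOL-Library.Extended_Nat" "Graph_Theory.Graph_Theory"
begin

text \<open>
  A (possibly infinite) simple undirected graph is a \<^locale>\<open>pair_bidirected_digraph\<close>: every edge
  between \<open>u\<close> and \<open>v\<close> is represented by the two arcs \<open>(u,v)\<close> and \<open>(v,u)\<close>. The following are the
  undirected edges of an arc list.
\<close>

definition sides :: "('a \<times> 'a) list \<Rightarrow> 'a set set" where
  "sides p = (\<lambda>(u, v). {u, v}) ` set p"

text \<open>
  A polygon is identified with its set of undirected edges, so its vertex set is \<open>\<Union>P\<close>. The
  cycles of length 2 of a bidirected graph are the arc lists \<open>[(u,v), (v,u)]\<close>; hence for \<open>k = 2\<close>
  the polygons are exactly the single edges \<open>{{u,v}}\<close>. For \<open>k \<ge> 3\<close> they are the usual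
  \<open>k\<close>-cycles.
\<close>

definition polygons :: "'a pair_pre_digraph \<Rightarrow> nat \<Rightarrow> 'a set set set" where
  "polygons G k = {sides c | c. pre_digraph.cycle (with_proj G) c \<and> length c = k}"

text \<open>
  A loop is trivial if it can be contracted by deleting backtrackings \<open>(u,v), (v,u)\<close>. Since the
  reduced form of a loop runs through no further edges, it suffices to consider reduced loops:
  nonempty closed walks without backtracking.
\<close>

definition nontrivial_loop :: "'a pair_pre_digraph \<Rightarrow> ('a \<times> 'a) list \<Rightarrow> bool" where
  "nontrivial_loop G p \<longleftrightarrow>
     (\<exists>u. pre_digraph.awalk (with_proj G) u p u) \<and> p \<noteq> [] \<and>
     successively (\<lambda>e f. f \<noteq> prod.swap e) p"

text \<open>
  For \<open>k = 2\<close> the two sides of the degenerate polygon \<open>[(u,v), (v,u)]\<close> are the two orientations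
  of one edge, and a loop has to pass through both of them. (If one passage sufficed, the loop
  condition would be void for \<open>k = 2\<close>; as stated, it says that the graph has no circuits,
  i.e. that it is a tree.)
\<close>

definition runs_through :: "nat \<Rightarrow> ('a \<times> 'a) list \<Rightarrow> ('a \<times> 'a) list \<Rightarrow> bool" where
  "runs_through k p c \<longleftrightarrow> (if k = 2 then set c \<subseteq> set p else sides c \<subseteq> sides p)"

locale symmetric_graph = pair_bidirected_digraph G for G :: "'a pair_pre_digraph" +
  fixes k r :: nat
  assumes connected: "connected (with_proj G)"
    and card_polygons: "v \<in> pverts G \<Longrightarrow> card {P \<in> polygons G k. v \<in> \<Union>P} = r"
    and polygons_meet:
      "\<lbrakk>v \<in> pverts G; P \<in> polygons G k; Q \<in> polygons G k; P \<noteq> Q; v \<in> \<Union>P; v \<in> \<Union>Q\<rbrakk>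
       \<Longrightarrow> P \<inter> Q = {} \<and> \<Union>P \<inter> \<Union>Q = {v}"
    and loops:
      "nontrivial_loop G p \<Longrightarrow>
       \<exists>c. pre_digraph.cycle (with_proj G) c \<and> length c = k \<and> runs_through k p c"

text \<open>
  The number of polygons crossed by a walk is the number of polygons having a side on it; walks
  run along sides of polygons. The infimum over the empty set is \<open>\<infinity>\<close>.
\<close>

definition polygon_dist :: "'a pair_pre_digraph \<Rightarrow> nat \<Rightarrow> 'a \<Rightarrow> 'a \<Rightarrow> enat" where
  "polygon_dist G k x y =
     (INF p \<in> {p. pre_digraph.awalk (with_proj G) x p y \<and> sides p \<subseteq> \<Union>(polygons G k)}.
        enat (card {P \<in> polygons G k. P \<inter> sides p \<noteq> {}}))"

definition sphere :: "'a pair_pre_digraph \<Rightarrow> nat \<Rightarrow> 'a \<Rightarrow> nat \<Rightarrow> 'a set" where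
  "sphere G k x n = {y \<in> pverts G. polygon_dist G k x y = enat n}"

definition laplacian ::
    "'a pair_pre_digraph \<Rightarrow> nat \<Rightarrow> nat \<Rightarrow> ('a \<Rightarrow> complex) \<Rightarrow> 'a \<Rightarrow> complex" where
  "laplacian G k r f x = f x - 1 / of_nat (r * (k - 1)) * (\<Sum>y \<in> sphere G k x 1. f y)"

end

theory Submission
  imports Defs
begin

text \<open>
  Say that two vertices are adjacent if they share a polygon. A chain of adjacent vertices is
  reduced if consecutive steps use different polygons. A shortest closed reduced chain would use
  pairwise distinct polygons, hence be realised by a nontrivial loop covering no polygon; so there
  is none, reduced chains are unique, and the distance is the length of the reduced chain. Counting
  the neighbours of \<open>x\<close> by their distance to \<open>z\<close> shows that the sphere sums \<open>A\<^sub>n\<close> satisfy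
  \<open>A\<^sub>1 A\<^sub>n = A\<^sub>n\<^sub>+\<^sub>1 + (k - 2) A\<^sub>n + c\<^sub>n A\<^sub>n\<^sub>-\<^sub>1\<close> with \<open>c\<^sub>1 = r (k - 1)\<close> and \<open>c\<^sub>n = (r - 1) (k - 1)\<close>
  otherwise. Hence each \<open>A\<^sub>n\<close> is a polynomial in \<open>A\<^sub>1\<close>: the \<open>A\<^sub>n\<close> commute, and \<open>A\<^sub>n\<close> acts on
  \<open>U\<close> equally in both variables, since \<open>A\<^sub>1\<close> does.
\<close>

context symmetric_graph
begin

section \<open>Polygons as cycles of arcs, and paths inside a polygon\<close>

text \<open>Dropping the first vertex of a walk leaves the heads of its arcs. In this form the
  condition is visibly invariant under rotating the cycle.\<close>

lemma cycle_iff_distinct_heads: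
  "cycle c \<longleftrightarrow> (\<exists>u. awalk u c u \<and> distinct (map snd c) \<and> c \<noteq> [])"
proof -
  have "tl (pawalk_verts u c) = map snd c" if "awalk u c u" for u
    using that awalk_verts_conv'[of u c u] by (auto simp: awalk_def)
  then show ?thesis by (auto simp: cycle_def)
qed

text \<open>On a closed walk the tail of each arc is the head of its cyclic predecessor.\<close>

lemma Union_sides_closed_walk:
  assumes "awalk u c u" "c \<noteq> []"
  shows "\<Union>(sides c) = snd ` set c"
proof -
  have 1: "fst ` set c \<subseteq> snd ` set c"
  proof
    fix x assume "x \<in> fst ` set c"
    then have "x \<in> set (pawalk_verts u c)"
      using set_awalk_verts[OF assms(1)] by auto
    moreover have "pawalk_verts u c = u # map snd c"
      using awalk_verts_conv'[of u c u] assms by (cases c) (auto simp: awalk_def)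
    moreover have "u = snd (last c)"
      using awalk_verts_conv[of u c] assms(1,2) by auto
    ultimately show "x \<in> snd ` set c" using assms(2) by auto
  qed
  have "\<Union>(sides c) = fst ` set c \<union> snd ` set c"
    by (force simp: sides_def)
  with 1 show ?thesis by auto
qed

lemma polygonE:
  assumes "P \<in> polygons G k"
  obtains c u where "P = sides c" "cycle c" "length c = k" "awalk u c u" "distinct (map snd c)"
    "c \<noteq> []" "\<Union>P = snd ` set c"
  using assms Union_sides_closed_walk unfolding polygons_def cycle_iff_distinct_heads by blast

lemma card_Union_polygon: "P \<in> polygons G k \<Longrightarrow> card (\<Union>P) = k"
  by (erule polygonE) (metis distinct_card length_map set_map)

lemma finite_Union_polygon: "P \<in> polygons G k \<Longrightarrow> finite (\<Union>P)"
  by (erule polygonE) simp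

lemma Union_polygon_subset: "P \<in> polygons G k \<Longrightarrow> \<Union>P \<subseteq> pverts G"
  by (erule polygonE) (auto simp: awalk_def dest: arc_snd_in_verts)

lemma polygons_disjoint:
  assumes "P \<in> polygons G k" "Q \<in> polygons G k" "E \<in> P" "E \<in> Q"
  shows "P = Q"
proof (rule ccontr)
  assume "P \<noteq> Q"
  obtain a where "a \<in> E"
    using assms(1,3) by (elim polygonE) (auto simp: sides_def)
  then show False
    using polygons_meet[of a P Q] Union_polygon_subset[OF assms(1)] assms \<open>P \<noteq> Q\<close> by blast
qed

text \<open>Two arcs with the same edge are equal or opposite. Opposite arcs \<open>(a, b)\<close>,
  \<open>(b, a)\<close> force the cycle to consist of these two alone, since its heads are
  distinct.\<close>

lemma card_sides_cycle:
  assumes "cycle c" "length c \<noteq> 2"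
  shows "card (sides c) = length c"
proof -
  obtain u where c: "awalk u c u" "distinct (map snd c)" "c \<noteq> []"
    using assms(1) cycle_iff_distinct_heads by auto
  have no_swap: False if sw: "(a, b) \<in> set c" "(b, a) \<in> set c" for a b
  proof -
    have "a \<noteq> b" using sw c(1) no_loops by (force simp: awalk_def)
    obtain c1 c2 where c12: "c = c1 @ (a, b) # c2" using sw(1) by (meson split_list)
    have w: "awalk a ((a, b) # c2 @ c1) a"
      using c(1) unfolding c12 by (auto simp: awalk_simps)
    have d: "distinct (map snd ((a, b) # c2 @ c1))" using c(2) unfolding c12 by auto
    have ba: "(b, a) \<in> set (c2 @ c1)" using sw(2) \<open>a \<noteq> b\<close> unfolding c12 by auto
    then obtain d1 d2 where d12: "c2 @ c1 = d1 @ (b, a) # d2" by (meson split_list)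
    \<comment> \<open>Were one of these closed pieces nonempty, it would enter \<open>b\<close> or
      \<open>a\<close> again, although \<open>(a, b)\<close> and \<open>(b, a)\<close> already
      do.\<close>
    have w2: "awalk b d1 b" "awalk a d2 a"
      using w unfolding d12 by (auto simp: awalk_simps)
    have "d1 = []"
    proof (rule ccontr)
      assume "d1 \<noteq> []"
      then have "b = snd (last d1)"
        using awalk_verts_conv[of b d1] w2(1) by auto
      with d \<open>d1 \<noteq> []\<close> show False unfolding d12 by auto
    qed
    moreover have "d2 = []"
    proof (rule ccontr)
      assume "d2 \<noteq> []"
      then have "a = snd (last d2)"
        using awalk_verts_conv[of a d2] w2(2) by auto
      with d \<open>d2 \<noteq> []\<close> show False unfolding d12 by auto
    qed
    ultimately have "length (c2 @ c1) = 1" using d12 by simp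
    then show False using assms(2) unfolding c12 by simp
  qed
  have "inj_on (\<lambda>(u, v). {u, v}) (set c)"
    by (rule inj_onI) (use no_swap in \<open>fastforce simp: doubleton_eq_iff\<close>)
  moreover have "distinct c" using c(2) distinct_map by auto
  ultimately show ?thesis
    by (simp add: sides_def card_image distinct_card)
qed

text \<open>The conclusion of the axiom \<open>loops\<close>: a nontrivial loop for which it fails
  is a contradiction.\<close>

definition covers_polygon :: "('a \<times> 'a) list \<Rightarrow> bool" where
  "covers_polygon p \<longleftrightarrow> (\<exists>c. cycle c \<and> length c = k \<and> runs_through k p c)"

text \<open>Covering takes two distinct arcs if \<open>k = 2\<close>, and \<open>k\<close> distinct
  edges otherwise.\<close>

lemma covers_polygon_length:
  assumes "covers_polygon p"
  shows "k \<le> length p"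
proof -
  obtain c where c: "cycle c" "length c = k" "runs_through k p c"
    using assms covers_polygon_def by auto
  show ?thesis
  proof (cases "k = 2")
    case True
    have "card (set c) = 2"
      using c(1,2) True cycle_iff_distinct_heads by (auto simp: distinct_map distinct_card)
    moreover have "card (set c) \<le> card (set p)"
      using c(3) True by (simp add: runs_through_def card_mono)
    ultimately show ?thesis using card_length[of p] True by linarith
  next
    case False
    have "k = card (sides c)" using card_sides_cycle c False by auto
    also have "\<dots> \<le> card (sides p)"
      using c(3) False by (simp add: runs_through_def sides_def card_mono)
    also have "\<dots> \<le> length p"
      unfolding sides_def by (meson card_image_le card_length finite_set le_trans)
    finally show ?thesis .
  qed
qed

lemma apath_no_backtrack:
  "apath u p v \<Longrightarrow> successively (\<lambda>e f. f \<noteq> prod.swap e) p"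
proof (induction p arbitrary: u)
  case (Cons e p)
  then show ?case
    by (cases p) (auto simp: apath_Cons_iff dest: hd_in_awalk_verts(2))
qed simp

text \<open>Rotate the cycle to start at \<open>a\<close> and stop at the arc entering
  \<open>b\<close>. At least the arc entering \<open>a\<close> is left out, so the path is too short
  to cover any polygon.\<close>

lemma polygon_path:
  assumes P: "P \<in> polygons G k" and ab: "a \<in> \<Union>P" "b \<in> \<Union>P" "a \<noteq> b"
  obtains p where "apath a p b" "p \<noteq> []" "sides p \<subseteq> P" "\<not> covers_polygon p"
proof -
  obtain c u where c: "P = sides c" "length c = k" "awalk u c u" "distinct (map snd c)"
    "\<Union>P = snd ` set c"
    using P by (elim polygonE)
  obtain e where e: "e \<in> set c" "snd e = a" using ab(1) c(5) by auto
  then obtain c1 c2 where c12: "c = c1 @ e # c2" by (meson split_list)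
  define c' where "c' = c2 @ c1 @ [e]"
  have c': "awalk a c' a" "distinct (map snd c')" "set c' = set c" "length c' = k"
    using c(2,3,4) e(2) unfolding c12 c'_def by (auto simp: awalk_simps)
  obtain f where f: "f \<in> set c'" "snd f = b" using ab(2) c(5) c'(3) by auto
  then obtain p q where pq: "c' = p @ f # q" by (meson split_list)
  have "q \<noteq> []"
  proof
    assume "q = []"
    then have "last c' = f" by (simp add: pq)
    then show False using ab(3) e f by (simp add: c'_def)
  qed
  then have "last q = e" using pq
    by (metis c'_def append_is_Nil_conv last_appendR last_snoc last_ConsR list.distinct(1))
  then have "e \<in> set q" using \<open>q \<noteq> []\<close> by auto
  let ?p = "p @ [f]"
  have w: "awalk a ?p b" using c'(1) f(2) unfolding pq by (auto simp: awalk_simps)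
  moreover have "pawalk_verts a ?p = a # map snd ?p"
    using awalk_verts_conv'[of a ?p b] w by (cases p) (auto simp: awalk_def)
  moreover have "a \<notin> snd ` set ?p" "distinct (map snd ?p)"
    using c'(2) \<open>e \<in> set q\<close> e(2) f(2) ab(3) unfolding pq by force+
  ultimately have "apath a ?p b" by (auto simp: apath_def)
  moreover have "set ?p \<subseteq> set c" using c'(3) unfolding pq by auto
  then have "sides ?p \<subseteq> P" unfolding c(1) sides_def by blast
  moreover have "length ?p < k" using c'(4) \<open>q \<noteq> []\<close> unfolding pq by (cases q) auto
  then have "\<not> covers_polygon ?p" using covers_polygon_length by force
  ultimately show ?thesis using that by blast
qed

section \<open>Chains of vertices sharing polygons\<close>

text \<open>Each step records its polygon along with the vertex reached, because reducedness is a
  condition on consecutive polygons.\<close>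

fun chain :: "'a \<Rightarrow> ('a set set \<times> 'a) list \<Rightarrow> 'a \<Rightarrow> bool" where
  "chain x [] z \<longleftrightarrow> x \<in> pverts G \<and> x = z"
| "chain x ((P, a) # s) z \<longleftrightarrow>
     P \<in> polygons G k \<and> x \<in> \<Union>P \<and> a \<in> \<Union>P \<and> x \<noteq> a \<and> chain a s z"

abbreviation reduced :: "('a set set \<times> 'a) list \<Rightarrow> bool" where
  "reduced s \<equiv> distinct_adj (map fst s)"

lemma chain_start: "chain x s z \<Longrightarrow> x \<in> pverts G"
  using Union_polygon_subset by (induction x s z rule: chain.induct) fastforce+

lemma chain_end: "chain x s z \<Longrightarrow> z \<in> pverts G"
  by (induction x s z rule: chain.induct) auto

lemma chain_polygons: "chain x s z \<Longrightarrow> fst ` set s \<subseteq> polygons G k"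
  by (induction x s z rule: chain.induct) auto

lemma chain_append: "chain x (s @ t) z \<longleftrightarrow> (\<exists>y. chain x s y \<and> chain y t z)"
  by (induction s arbitrary: x) (auto dest: chain_start)

text \<open>A step stores only its end vertex, so reversal shifts the vertices by one and needs the
  start vertex as an argument.\<close>

fun rev_chain :: "'a \<Rightarrow> ('a set set \<times> 'a) list \<Rightarrow> ('a set set \<times> 'a) list" where
  "rev_chain x [] = []"
| "rev_chain x ((P, a) # s) = rev_chain a s @ [(P, x)]"

lemma map_fst_rev_chain: "map fst (rev_chain x s) = rev (map fst s)"
  by (induction x s rule: rev_chain.induct) auto

lemma rev_chain_eq_Nil_iff: "rev_chain x s = [] \<longleftrightarrow> s = []"
  by (cases s) auto

lemma chain_rev_chain: "chain x s z \<Longrightarrow> chain z (rev_chain x s) x"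
proof (induction x s z rule: chain.induct)
  case (2 x P a s z)
  then show ?case using Union_polygon_subset by (auto simp: chain_append)
qed auto

section \<open>Nonexistence of closed reduced chains\<close>

lemma sides_append: "sides (p @ q) = sides p \<union> sides q"
  by (auto simp: sides_def)

text \<open>Since distinct polygons share no side, a concatenation of arcs of distinct polygons covers
  a polygon only if one of the arcs already does.\<close>

lemma realise_chain:
  assumes "chain x s z" "distinct (map fst s)"
  shows "\<exists>p. awalk x p z \<and> successively (\<lambda>e f. f \<noteq> prod.swap e) p \<and> \<not> covers_polygon p \<and>
    (s \<noteq> [] \<longrightarrow> p \<noteq> []) \<and> sides p \<subseteq> \<Union>(fst ` set s)"
  using assms
proof (induction s arbitrary: x)
  case Nil
  have "\<not> covers_polygon []"
    by (auto simp: covers_polygon_def runs_through_def sides_def cycle_iff_distinct_heads)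
  with Nil show ?case by (auto simp: awalk_simps sides_def)
next
  case (Cons Pa s)
  obtain P a where Pa: "Pa = (P, a)" by fastforce
  have P: "P \<in> polygons G k" "x \<in> \<Union>P" "a \<in> \<Union>P" "x \<noteq> a" and s: "chain a s z"
    and P_notin: "P \<notin> fst ` set s"
    using Cons.prems by (auto simp: Pa)
  obtain p where p: "awalk x p a" "successively (\<lambda>e f. f \<noteq> prod.swap e) p" "p \<noteq> []"
    "sides p \<subseteq> P" "\<not> covers_polygon p"
    by (rule polygon_path[OF P]) (blast intro: apath_no_backtrack awalkI_apath)
  obtain q where q: "awalk a q z" "successively (\<lambda>e f. f \<noteq> prod.swap e) q" "\<not> covers_polygon q"
    "sides q \<subseteq> \<Union>(fst ` set s)"
    using Cons.IH[OF s] Cons.prems(2) by auto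
  have polys: "fst ` set s \<subseteq> polygons G k" using chain_polygons[OF s] .
  have disj: "P \<inter> sides q = {}"
  proof (rule ccontr)
    assume "P \<inter> sides q \<noteq> {}"
    then obtain E where "E \<in> P" "E \<in> sides q" by auto
    moreover from this obtain Q where "E \<in> Q" "Q \<in> fst ` set s"
      using q(4) by (meson UnionE subsetD)
    ultimately show False using polygons_disjoint[OF P(1), of Q E] polys P_notin by auto
  qed
  have side: "{fst e, snd e} \<in> sides r" if "e \<in> set r" for e :: "'a \<times> 'a" and r
    unfolding sides_def by (rule image_eqI[OF _ that]) (simp add: case_prod_beta)
  \<comment> \<open>A backtrack at the joint would give \<open>q\<close> an edge of
    \<open>P\<close>.\<close>
  have no_bt: "hd q \<noteq> prod.swap (last p)" if "q \<noteq> []"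
  proof
    assume eq: "hd q = prod.swap (last p)"
    have "{fst (last p), snd (last p)} \<in> P" using side[of "last p" p] p(3,4) by auto
    moreover have "{fst (last p), snd (last p)} \<in> sides q"
      using side[OF hd_in_set[OF that]] unfolding eq by (simp add: insert_commute)
    ultimately show False using disj by blast
  qed
  have "\<not> covers_polygon (p @ q)"
  proof
    assume "covers_polygon (p @ q)"
    then obtain c where c: "cycle c" "length c = k" "runs_through k (p @ q) c"
      by (auto simp: covers_polygon_def)
    have C: "sides c \<in> polygons G k" using c by (auto simp: polygons_def)
    show False
    proof (cases "sides c = P")
      case True
      then have "sides c \<inter> sides q = {}" using disj by simp
      \<comment> \<open>\<open>runs_through\<close> compares arcs if \<open>k = 2\<close> and edges
        otherwise, so disjointness is needed for both.\<close>
      moreover from this have "set c \<inter> set q = {}"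
        using side[of _ c] side[of _ q] by (meson disjoint_iff)
      ultimately have "runs_through k p c"
        using c(3) by (auto simp: runs_through_def sides_append split: if_splits)
      then show False using c p(5) by (auto simp: covers_polygon_def)
    next
      case False
      then have "sides c \<inter> sides p = {}" using polygons_disjoint[OF C P(1)] p(4) by blast
      moreover from this have "set c \<inter> set p = {}"
        using side[of _ c] side[of _ p] by (meson disjoint_iff)
      ultimately have "runs_through k q c"
        using c(3) by (auto simp: runs_through_def sides_append split: if_splits)
      then show False using c q(3) by (auto simp: covers_polygon_def)
    qed
  qed
  moreover have "awalk x (p @ q) z" using p(1) q(1) by auto
  moreover have "successively (\<lambda>e f. f \<noteq> prod.swap e) (p @ q)"
    using p(2) q(2) no_bt by (auto simp: successively_append_iff)
  moreover have "sides (p @ q) \<subseteq> \<Union>(fst ` set (Pa # s))"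
    using p(4) q(4) by (auto simp: Pa sides_append)
  ultimately show ?case using p(3) by (intro exI[of _ "p @ q"]) (simp add: Pa)
qed

text \<open>Two visits to the same polygon can be joined inside it, which closes the chain up in between.\<close>

lemma repeated_polygon_shortcut:
  assumes "chain x s z" "reduced s" "\<not> distinct (map fst s)"
  obtains y t where "chain y t y" "reduced t" "t \<noteq> []" "length t < length s"
proof -
  obtain us P vs ws where d: "map fst s = us @ P # vs @ P # ws"
    using not_distinct_decomp[OF assms(3)] by auto
  obtain s1 a s2 b s3 where s: "s = s1 @ (P, a) # s2 @ (P, b) # s3"
  proof -
    have split: "\<exists>v w a. t = v @ (P, a) # w \<and> map fst w = bs"
      if "map fst t = as @ P # bs" for t :: "('a set set \<times> 'a) list" and as bs
    proof -
      from that obtain v w where "t = v @ w" "map fst w = P # bs"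
        unfolding map_eq_append_conv by auto
      then obtain a w' where "t = v @ (P, a) # w'" "map fst w' = bs"
        by (cases w) auto
      then show ?thesis by blast
    qed
    obtain s1 t a where s: "s = s1 @ (P, a) # t" and t: "map fst t = vs @ P # ws"
      using split[OF d] by auto
    obtain s2 s3 b where "t = s2 @ (P, b) # s3"
      using split[OF t] by auto
    with s show thesis using that by simp
  qed
  obtain c where c: "chain a s2 c" "c \<in> \<Union>P" "a \<in> \<Union>P" "P \<in> polygons G k"
    using assms(1) unfolding s by (auto simp: chain_append)
  \<comment> \<open>The part of \<open>s\<close> between the two visits, with both visits kept:
    \<open>s2\<close> is nonempty and neither begins nor ends with \<open>P\<close>.\<close>
  have red: "distinct_adj (P # map fst s2 @ [P])"
    using assms(2) distinct_adj_appendD1[of "P # map fst s2 @ [P]" "map fst s3"]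
      distinct_adj_appendD2[of "map fst s1" "P # map fst s2 @ P # map fst s3"]
    unfolding s by simp
  then have ne: "s2 \<noteq> []" by auto
  have red2: "distinct_adj (map fst s2 @ [P])" using red by (rule distinct_adj_ConsD)
  then have red1: "distinct_adj (map fst s2)" by (rule distinct_adj_appendD1)
  show ?thesis
  proof (cases "a = c")
    case True
    then show ?thesis using that[of a s2] c ne red1 by (simp add: s)
  next
    case False
    \<comment> \<open>The closing step from \<open>c\<close> to \<open>a\<close> inside
      \<open>P\<close> replaces the two visits, so the result is still shorter than
      \<open>s\<close>.\<close>
    then have "chain a (s2 @ [(P, a)]) a"
      using c chain_start by (auto simp: chain_append)
    then show ?thesis using that[of a "s2 @ [(P, a)]"] red2 by (simp add: s)
  qed
qed

text \<open>Descent on the length: a repeated polygon yields a shorter counterexample, and distinct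
  polygons yield a loop that contradicts \<open>loops\<close>.\<close>

lemma no_closed_reduced_chain:
  assumes "chain x s x" "reduced s"
  shows "s = []"
  using assms
proof (induction "length s" arbitrary: x s rule: less_induct)
  case less
  show ?case
  proof (cases "distinct (map fst s)")
    case True
    show ?thesis
    proof (rule ccontr)
      assume "s \<noteq> []"
      then obtain p where "awalk x p x" "successively (\<lambda>e f. f \<noteq> prod.swap e) p"
        "\<not> covers_polygon p" "p \<noteq> []"
        using realise_chain[OF less.prems(1) True] by blast
      then show False using loops[of p] by (auto simp: nontrivial_loop_def covers_polygon_def)
    qed
  next
    case False
    then obtain y t where "chain y t y" "reduced t" "t \<noteq> []" "length t < length s"
      by (rule repeated_polygon_shortcut[OF less.prems])
    then show ?thesis using less.hyps by blast
  qed
qed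

lemma distinct_reduced_chain: "chain x s z \<Longrightarrow> reduced s \<Longrightarrow> distinct (map fst s)"
  by (meson repeated_polygon_shortcut no_closed_reduced_chain)

section \<open>Uniqueness and existence of reduced chains\<close>

text \<open>Running back along \<open>s\<close> and out along \<open>t\<close> gives a closed chain
  at \<open>z\<close>; it is reduced because the polygons at the turn in \<open>x\<close>
  differ.\<close>

lemma reduced_chains_diverge:
  assumes s: "chain x s z" "reduced s" and t: "chain x t z" "reduced t"
    and hd: "s \<noteq> [] \<Longrightarrow> t \<noteq> [] \<Longrightarrow> fst (hd s) \<noteq> fst (hd t)"
  shows "s = [] \<and> t = []"
proof -
  have "chain z (rev_chain x s @ t) z"
    using chain_rev_chain[OF s(1)] t(1) by (auto simp: chain_append)
  moreover have "reduced (rev_chain x s @ t)"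
    using s(2) t(2) hd
    by (auto simp: map_fst_rev_chain distinct_adj_append_iff last_rev hd_map)
  ultimately show ?thesis
    using no_closed_reduced_chain rev_chain_eq_Nil_iff by blast
qed

lemma reduced_chain_unique:
  assumes "chain x s z" "reduced s" "chain x t z" "reduced t"
  shows "s = t"
  using assms
proof (induction s arbitrary: x t)
  case Nil
  then show ?case using reduced_chains_diverge[of x "[]" z t] by auto
next
  case (Cons Pa s)
  obtain P a where Pa: "Pa = (P, a)" by fastforce
  obtain Q b t' where t: "t = (Q, b) # t'"
    using reduced_chains_diverge[OF Cons.prems] by (cases t) auto
  have PQ: "P = Q"
    using reduced_chains_diverge[OF Cons.prems] by (auto simp: Pa t)
  have red: "reduced s" "reduced t'" using Cons.prems by (auto simp: t distinct_adj_Cons)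
  have "a = b"
  proof (rule ccontr)
    assume "a \<noteq> b"
    \<comment> \<open>Since \<open>a\<close> also lies in the first polygon of \<open>t\<close>, the
      same steps can start at \<open>a\<close>; there \<open>s\<close> and \<open>t\<close> diverge,
      although \<open>t\<close> is nonempty.\<close>
    then have "chain a t z" using Cons.prems by (auto simp: Pa t PQ)
    moreover have "chain a s z" using Cons.prems by (auto simp: Pa)
    moreover have "fst (hd s) \<noteq> P" if "s \<noteq> []"
      using Cons.prems(2) that by (cases s) (auto simp: Pa distinct_adj_Cons)
    ultimately show False
      using reduced_chains_diverge[of a s z t] red Cons.prems(4) by (auto simp: t PQ)
  qed
  with Cons.prems red show ?case by (auto simp: Pa t PQ intro: Cons.IH)
qed

text \<open>Two consecutive steps in one polygon cancel or merge into one. No new polygon appears,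
  which the lower bound for the distance relies on.\<close>

lemma reduce_chain:
  assumes "chain x s z"
  obtains t where "chain x t z" "reduced t" "fst ` set t \<subseteq> fst ` set s"
  using assms
proof (induction s arbitrary: x thesis)
  case (Cons Pa s)
  obtain P a where Pa: "Pa = (P, a)" by fastforce
  obtain t where t: "chain a t z" "reduced t" "fst ` set t \<subseteq> fst ` set s"
    using Cons.IH Cons.prems(2) by (auto simp: Pa)
  consider "t = [] \<or> fst (hd t) \<noteq> P" | b t' where "t = (P, b) # t'"
    by (metis list.exhaust_sel prod.collapse)
  then show ?case
  proof cases
    case 1
    then show ?thesis
      using Cons.prems t by (intro Cons.prems(1)[of "(P, a) # t"])
        (auto simp: Pa distinct_adj_Cons hd_map)
  next
    case 2
    show ?thesis
    proof (cases "b = x")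
      case True
      then show ?thesis using t 2 by (intro Cons.prems(1)[of t']) (auto simp: distinct_adj_Cons)
    next
      case False
      then show ?thesis using t 2 Cons.prems(2) by (intro Cons.prems(1)[of t]) (auto simp: Pa)
    qed
  qed
qed auto

section \<open>The distance as the length of the reduced chain\<close>

abbreviation crossed :: "('a \<times> 'a) list \<Rightarrow> 'a set set set" where
  "crossed p \<equiv> {P \<in> polygons G k. P \<inter> sides p \<noteq> {}}"

text \<open>Each edge of the walk lies in at most one polygon. Finiteness matters because
  \<open>card\<close> is 0 on infinite sets.\<close>

lemma finite_crossed: "finite (crossed p)"
proof -
  have "crossed p \<subseteq> (\<lambda>E. THE P. P \<in> polygons G k \<and> E \<in> P) ` sides p"
  proof
    fix P assume "P \<in> crossed p"
    then obtain E where E: "P \<in> polygons G k" "E \<in> P" "E \<in> sides p" by auto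
    then have "(THE P. P \<in> polygons G k \<and> E \<in> P) = P"
      using polygons_disjoint by (intro the_equality) auto
    with E(3) show "P \<in> (\<lambda>E. THE P. P \<in> polygons G k \<and> E \<in> P) ` sides p" by force
  qed
  then show ?thesis by (rule finite_subset) (simp add: sides_def)
qed

lemma chain_of_walk:
  assumes "awalk x p z" "sides p \<subseteq> \<Union>(polygons G k)"
  obtains s where "chain x s z" "fst ` set s \<subseteq> crossed p"
  using assms
proof (induction p arbitrary: x thesis)
  case Nil
  then show ?case by (auto simp: awalk_simps intro: Nil(1)[of "[]"])
next
  case (Cons e p)
  obtain y where e: "e = (x, y)" using Cons.prems(2) by (cases e) (auto simp: awalk_simps)
  obtain s where s: "chain y s z" "fst ` set s \<subseteq> crossed p"
    using Cons.IH[of y] Cons.prems(2,3) sides_append[of "[e]" p] by (auto simp: e awalk_simps)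
  obtain P where P: "P \<in> polygons G k" "{x, y} \<in> P"
    using Cons.prems(3) by (auto simp: e sides_def)
  have "x \<noteq> y" using Cons.prems(2) no_loops by (force simp: awalk_simps e)
  with P s show ?case
    by (intro Cons.prems(1)[of "(P, y) # s"]) (auto simp: e sides_def)
qed

lemma walk_of_chain:
  assumes "chain x s z"
  obtains p where "awalk x p z" "sides p \<subseteq> \<Union>(fst ` set s)"
  using assms
proof (induction s arbitrary: x thesis)
  case Nil
  then show ?case by (auto simp: awalk_simps sides_def intro: Nil(1)[of "[]"])
next
  case (Cons Pa s)
  obtain P a where Pa: "Pa = (P, a)" by fastforce
  obtain q where q: "awalk a q z" "sides q \<subseteq> \<Union>(fst ` set s)"
    using Cons.IH Cons.prems(2) by (auto simp: Pa)
  obtain p where "awalk x p a" "sides p \<subseteq> P"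
    using polygon_path[of P x a] Cons.prems(2) awalkI_apath unfolding Pa chain.simps by metis
  with q show ?case
    by (intro Cons.prems(1)[of "p @ q"]) (auto simp: Pa sides_append)
qed

text \<open>A walk realising \<open>s\<close> crosses only polygons of \<open>s\<close>. Conversely,
  any walk gives a chain through crossed polygons, whose reduction is \<open>s\<close> by
  uniqueness, so all polygons of \<open>s\<close> are crossed.\<close>

lemma polygon_dist_reduced_chain:
  assumes s: "chain x s z" "reduced s"
  shows "polygon_dist G k x z = enat (length s)"
proof -
  have card: "card (fst ` set s) = length s"
    using distinct_reduced_chain[OF s] distinct_card by fastforce
  let ?W = "{p. awalk x p z \<and> sides p \<subseteq> \<Union>(polygons G k)}"
  show ?thesis unfolding polygon_dist_def
  proof (rule antisym)
    obtain p where p: "awalk x p z" "sides p \<subseteq> \<Union>(fst ` set s)"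
      by (rule walk_of_chain[OF s(1)])
    have "crossed p \<subseteq> fst ` set s"
    proof
      fix P assume "P \<in> crossed p"
      then obtain E where E: "P \<in> polygons G k" "E \<in> P" "E \<in> sides p" by auto
      with p(2) obtain Q where "Q \<in> fst ` set s" "E \<in> Q" by (meson UnionE subsetD)
      then show "P \<in> fst ` set s"
        using polygons_disjoint[OF E(1) _ E(2)] chain_polygons[OF s(1)] by auto
    qed
    then have "card (crossed p) \<le> length s"
      unfolding card[symmetric] by (rule card_mono[rotated]) simp
    moreover have "p \<in> ?W" using p chain_polygons[OF s(1)] by (auto dest: subsetD)
    ultimately show "(INF p\<in>?W. enat (card (crossed p))) \<le> enat (length s)"
      by (intro INF_lower2[of p]) simp_all
  next
    show "enat (length s) \<le> (INF p\<in>?W. enat (card (crossed p)))"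
    proof (rule INF_greatest)
      fix p assume "p \<in> ?W"
      then have p: "awalk x p z" "sides p \<subseteq> \<Union>(polygons G k)" by simp_all
      obtain t where t: "chain x t z" "fst ` set t \<subseteq> crossed p"
        by (rule chain_of_walk[OF p])
      obtain t' where t': "chain x t' z" "reduced t'" "fst ` set t' \<subseteq> fst ` set t"
        using reduce_chain[OF t(1)] .
      have "t' = s" using reduced_chain_unique[OF t'(1,2) s] .
      then have "fst ` set s \<subseteq> crossed p" using t(2) t'(3) by (simp only: order.trans)
      then show "enat (length s) \<le> enat (card (crossed p))"
        using card_mono[OF finite_crossed, of "fst ` set s" p] card by simp
    qed
  qed
qed

lemma polygon_dist_eq_enat_iff:
  "polygon_dist G k x z = enat n \<longleftrightarrow> (\<exists>s. chain x s z \<and> reduced s \<and> length s = n)"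
proof
  assume n: "polygon_dist G k x z = enat n"
  \<comment> \<open>The infimum over no walks would be infinite.\<close>
  have "{p. awalk x p z \<and> sides p \<subseteq> \<Union>(polygons G k)} \<noteq> {}"
  proof
    assume "{p. awalk x p z \<and> sides p \<subseteq> \<Union>(polygons G k)} = {}"
    with n show False unfolding polygon_dist_def by (simp only:) (simp add: top_enat_def)
  qed
  then obtain p where p: "awalk x p z" "sides p \<subseteq> \<Union>(polygons G k)" by auto
  obtain s where "chain x s z" by (rule chain_of_walk[OF p])
  then obtain t where t: "chain x t z" "reduced t" by (rule reduce_chain)
  with n show "\<exists>s. chain x s z \<and> reduced s \<and> length s = n"
    using polygon_dist_reduced_chain[OF t] by auto
qed (auto dest: polygon_dist_reduced_chain)

section \<open>Spheres and their cardinalities\<close>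

lemma mem_sphere_iff:
  "z \<in> sphere G k x n \<longleftrightarrow> (\<exists>s. chain x s z \<and> reduced s \<and> length s = n)"
  unfolding sphere_def polygon_dist_eq_enat_iff by (auto dest: chain_end)

lemma sphere_0: "x \<in> pverts G \<Longrightarrow> sphere G k x 0 = {x}"
  by (auto simp: mem_sphere_iff)

lemma chain_end_in_sphere:
  "chain x s z \<Longrightarrow> reduced s \<Longrightarrow> z \<in> sphere G k x n \<longleftrightarrow> n = length s"
  unfolding mem_sphere_iff by (metis reduced_chain_unique)

lemma chain_single: "chain x [(P, a)] a \<longleftrightarrow> P \<in> polygons G k \<and> x \<in> \<Union>P \<and> a \<in> \<Union>P \<and> x \<noteq> a"
  using Union_polygon_subset[of P] by (auto simp del: Union_iff)

lemma sphere_1: "sphere G k x 1 = (\<Union>P\<in>{P \<in> polygons G k. x \<in> \<Union>P}. \<Union>P - {x})"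
proof (rule set_eqI)
  fix z
  have "z \<in> sphere G k x 1 \<longleftrightarrow> (\<exists>P. chain x [(P, z)] z)" (is "?L \<longleftrightarrow> ?R")
  proof
    assume ?L
    then obtain s where s: "chain x s z" "length s = 1" unfolding mem_sphere_iff by auto
    then obtain P a where "s = [(P, a)]" by (cases s) auto
    with s(1) have "chain x [(P, z)] z" by (auto simp del: Union_iff)
    then show ?R ..
  next
    assume ?R
    then show ?L using chain_end_in_sphere by fastforce
  qed
  also have "\<dots> \<longleftrightarrow> z \<in> (\<Union>P\<in>{P \<in> polygons G k. x \<in> \<Union>P}. \<Union>P - {x})"
    unfolding chain_single by blast
  finally show "?L \<longleftrightarrow> z \<in> (\<Union>P\<in>{P \<in> polygons G k. x \<in> \<Union>P}. \<Union>P - {x})" .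
qed

text \<open>The \<open>r\<close> polygons at \<open>x\<close> meet only in \<open>x\<close>, and
  each contributes \<open>k - 1\<close> neighbours.\<close>

lemma card_sphere_1:
  assumes "x \<in> pverts G" "r > 0"
  shows "card (sphere G k x 1) = r * (k - 1)" "finite (sphere G k x 1)"
proof -
  let ?\<P> = "{P \<in> polygons G k. x \<in> \<Union>P}"
  have card: "card ?\<P> = r" using card_polygons assms(1) .
  \<comment> \<open>A family of cardinality 0 could be infinite; \<open>r > 0\<close> excludes
    this.\<close>
  then have fin: "finite ?\<P>" using assms(2) card_gt_0_iff by metis
  have "card (\<Union>P\<in>?\<P>. \<Union>P - {x}) = (\<Sum>P\<in>?\<P>. card (\<Union>P - {x}))"
  proof (rule card_UN_disjoint[OF fin])
    show "\<forall>P\<in>?\<P>. finite (\<Union>P - {x})" using finite_Union_polygon by simp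
    show "\<forall>P\<in>?\<P>. \<forall>Q\<in>?\<P>. P \<noteq> Q \<longrightarrow> (\<Union>P - {x}) \<inter> (\<Union>Q - {x}) = {}"
    proof (intro ballI impI)
      fix P Q assume "P \<in> ?\<P>" "Q \<in> ?\<P>" "P \<noteq> Q"
      then have "\<Union>P \<inter> \<Union>Q = {x}" using polygons_meet[OF assms(1), of P Q] by simp
      then show "(\<Union>P - {x}) \<inter> (\<Union>Q - {x}) = {}" by blast
    qed
  qed
  also have "\<dots> = (\<Sum>P\<in>?\<P>. k - 1)"
    by (rule sum.cong) (auto simp: card_Union_polygon finite_Union_polygon)
  also have "\<dots> = r * (k - 1)" unfolding sum_constant card by simp
  finally show "card (sphere G k x 1) = r * (k - 1)" unfolding sphere_1 .
  show "finite (sphere G k x 1)" unfolding sphere_1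
    using fin finite_Union_polygon by (intro finite_UN_I) auto
qed

lemma sphere_subset_pverts: "sphere G k x n \<subseteq> pverts G"
  by (auto simp: sphere_def)

lemma sphere_Suc_subset: "sphere G k x (Suc n) \<subseteq> (\<Union>y\<in>sphere G k x 1. sphere G k y n)"
proof
  fix z assume "z \<in> sphere G k x (Suc n)"
  then obtain P a s where s: "chain x ((P, a) # s) z" "reduced ((P, a) # s)" "length s = n"
    by (auto simp: mem_sphere_iff length_Suc_conv)
  have "chain x [(P, a)] a" using s(1) chain_start[of a s z] by simp
  then have "a \<in> sphere G k x 1" using chain_end_in_sphere by fastforce
  moreover have "z \<in> sphere G k a n"
    using s by (auto simp: mem_sphere_iff distinct_adj_Cons)
  ultimately show "z \<in> (\<Union>y\<in>sphere G k x 1. sphere G k y n)" by blast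
qed

lemma finite_sphere:
  assumes "r > 0" "x \<in> pverts G"
  shows "finite (sphere G k x n)"
  using assms(2)
proof (induction n arbitrary: x)
  case (Suc n)
  then show ?case
    using sphere_Suc_subset[of x n] card_sphere_1(2)[OF _ assms(1)] sphere_subset_pverts
    by (meson finite_UN_I finite_subset subsetD)
qed (simp add: sphere_0)

text \<open>With \<open>(Q, b)\<close> the first step of the reduced chain from \<open>x\<close> to \<open>z\<close>, passing from \<open>x\<close> to a
  neighbour decreases the distance to \<open>z\<close> for \<open>b\<close>, preserves it for the other vertices of \<open>Q\<close>,
  and increases it for the vertices of the other polygons at \<open>x\<close>.\<close>

lemma card_neighbours_in_sphere:
  assumes r: "r > 0" and z: "z \<in> sphere G k x m" and "n \<ge> 1"
  shows "card {y \<in> sphere G k x 1. z \<in> sphere G k y n} =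
    (if m = Suc n then 1 else if m = n then k - 2
     else if Suc m = n then (if n = 1 then r else r - 1) * (k - 1) else 0)"
proof -
  obtain s where s: "chain x s z" "reduced s" "length s = m"
    using z by (auto simp: mem_sphere_iff)
  have x: "x \<in> pverts G" using chain_start s(1) .
  show ?thesis
  proof (cases s)
    case Nil
    then have "z = x" "m = 0" using s by auto
    \<comment> \<open>At \<open>z = x\<close> there is no first polygon and all neighbours move
      away, whence the exceptional coefficient for \<open>n = 1\<close>.\<close>
    have "x \<in> sphere G k y n \<longleftrightarrow> n = 1" if "y \<in> sphere G k x 1" for y
    proof -
      obtain P where "P \<in> polygons G k" "x \<in> \<Union>P" "y \<in> \<Union>P" "y \<noteq> x"
        using \<open>y \<in> sphere G k x 1\<close> unfolding sphere_1 by blast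
      then have "chain y [(P, x)] x" by (simp only: chain_single simp_thms)
      then show ?thesis using chain_end_in_sphere by fastforce
    qed
    then have "{y \<in> sphere G k x 1. z \<in> sphere G k y n} = (if n = 1 then sphere G k x 1 else {})"
      using \<open>z = x\<close> by auto
    then show ?thesis using card_sphere_1[OF x r] \<open>m = 0\<close> \<open>n \<ge> 1\<close> by auto
  next
    case (Cons Qb s')
    obtain Q b where Qb: "Qb = (Q, b)" by fastforce
    have Q: "Q \<in> polygons G k" "x \<in> \<Union>Q" "b \<in> \<Union>Q" "x \<noteq> b" and s': "chain b s' z" "reduced s'"
      and m: "m = Suc (length s')"
      using s by (auto simp: Cons Qb distinct_adj_Cons)
    have toward: "z \<in> sphere G k b n \<longleftrightarrow> n = length s'"
      using chain_end_in_sphere s' .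
    have along: "z \<in> sphere G k y n \<longleftrightarrow> n = m" if "y \<in> \<Union>Q" "y \<noteq> b" for y
    proof -
      have "chain y s z" using that Q s' by (auto simp: Cons Qb)
      then show ?thesis using chain_end_in_sphere s by blast
    qed
    have away: "z \<in> sphere G k y n \<longleftrightarrow> n = Suc m" if y: "y \<in> sphere G k x 1" "y \<notin> \<Union>Q" for y
    proof -
      obtain P where "P \<in> polygons G k" "x \<in> \<Union>P" "y \<in> \<Union>P" "y \<noteq> x"
        using y(1) unfolding sphere_1 by blast
      moreover have "P \<noteq> Q" using \<open>y \<in> \<Union>P\<close> y(2) by auto
      ultimately have "chain y ((P, x) # s) z" "reduced ((P, x) # s)"
        using s by (auto simp: Cons Qb)
      then show ?thesis using chain_end_in_sphere s(3) by fastforce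
    qed
    have sub: "\<Union>Q - {x} \<subseteq> sphere G k x 1"
      using Q unfolding sphere_1 by blast
    have eq: "{y \<in> sphere G k x 1. z \<in> sphere G k y n} =
      (if m = Suc n then {b} else if m = n then \<Union>Q - {x} - {b}
       else if Suc m = n then sphere G k x 1 - (\<Union>Q - {x}) else {})" (is "?L = ?R")
    proof (rule set_eqI)
      fix y
      have "x \<notin> sphere G k x 1" unfolding sphere_1 by blast
      then consider "y \<notin> sphere G k x 1" "y \<notin> \<Union>Q - {x}" | "y \<in> sphere G k x 1" "y = b"
        | "y \<in> sphere G k x 1" "y \<in> \<Union>Q" "y \<noteq> b" "y \<noteq> x" | "y \<in> sphere G k x 1" "y \<notin> \<Union>Q"
        using sub by blast
      then show "y \<in> ?L \<longleftrightarrow> y \<in> ?R"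
      proof cases
        case 1
        then show ?thesis using Q by auto
      next
        case 2
        then show ?thesis using toward m Q by auto
      next
        case 3
        then show ?thesis using along by auto
      next
        case 4
        then show ?thesis using away Q(3) by auto
      qed
    qed
    have "card (\<Union>Q - {x}) = k - 1" "card (\<Union>Q - {x} - {b}) = k - 2"
      using Q card_Union_polygon finite_Union_polygon by auto
    moreover have "card (sphere G k x 1 - (\<Union>Q - {x})) = (r - 1) * (k - 1)"
      using card_Diff_subset[OF _ sub] finite_Union_polygon[OF Q(1)] card_sphere_1[OF x r]
        \<open>card (\<Union>Q - {x}) = k - 1\<close> by (simp add: diff_mult_distrib)
    \<comment> \<open>Here \<open>m\<close> is positive, so \<open>Suc m = n\<close> forces
      \<open>n > 1\<close> and the factor is \<open>r - 1\<close>.\<close>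
    ultimately show ?thesis unfolding eq using m by auto
  qed
qed

section \<open>The algebra of sphere sums\<close>

text \<open>The operator \<open>A\<^sub>n\<close> of the overview; \<open>sphere_sum n\<close> maps
  functions to functions, so that such operators compose.\<close>

definition sphere_sum :: "nat \<Rightarrow> ('a \<Rightarrow> complex) \<Rightarrow> 'a \<Rightarrow> complex" where
  "sphere_sum n f x = (\<Sum>z\<in>sphere G k x n. f z)"

text \<open>Double counting: on the left, \<open>f z\<close> occurs once for each neighbour
  \<open>y\<close> of \<open>x\<close> at distance \<open>n\<close> from \<open>z\<close>.\<close>

lemma sphere_sum_recurrence:
  assumes r: "r > 0" and x: "x \<in> pverts G" and n: "n \<ge> 1"
  shows "sphere_sum 1 (sphere_sum n f) x = sphere_sum (Suc n) f x +
    of_nat (k - 2) * sphere_sum n f x +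
    of_nat ((if n = 1 then r else r - 1) * (k - 1)) * sphere_sum (n - 1) f x"
proof -
  let ?S = "sphere G k x" and ?N = "sphere G k x 1"
  let ?c = "(if n = 1 then r else r - 1) * (k - 1)"
  have fin: "finite (?S m)" for m using finite_sphere r x by blast
  have disj: "?S i \<inter> ?S j = {}" if "i \<noteq> j" for i j
    using that by (auto simp: sphere_def)
  define B where "B = ?S (Suc n) \<union> (?S n \<union> ?S (n - 1))"
  define w where "w z = card {y \<in> ?N. z \<in> sphere G k y n}" for z
  have "sphere G k y n \<subseteq> B" if y: "y \<in> ?N" for y
  proof
    fix z assume z: "z \<in> sphere G k y n"
    obtain s where s: "chain x s y" using y by (auto simp: mem_sphere_iff)
    obtain t where t: "chain y t z" using z by (auto simp: mem_sphere_iff)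
    from s t obtain u where "chain x u z" "reduced u"
      by (meson reduce_chain chain_append)
    then have "z \<in> ?S (length u)" by (auto simp: mem_sphere_iff)
    \<comment> \<open>As \<open>y\<close> itself is counted, the neighbour count is nonzero, which
      leaves only three possible distances.\<close>
    moreover from this have "card {y \<in> ?N. z \<in> sphere G k y n} \<noteq> 0"
      using y z fin by auto
    ultimately have "length u \<in> {Suc n, n, n - 1}"
      using card_neighbours_in_sphere[OF r _ n, of z x "length u"] by (auto split: if_splits)
    then show "z \<in> B" using \<open>z \<in> ?S (length u)\<close> by (auto simp: B_def)
  qed
  then have "sphere_sum 1 (sphere_sum n f) x = (\<Sum>y\<in>?N. \<Sum>z\<in>{z \<in> B. z \<in> sphere G k y n}. f z)"
    unfolding sphere_sum_def by (intro sum.cong) auto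
  also have "\<dots> = (\<Sum>z\<in>B. \<Sum>y\<in>{y \<in> ?N. z \<in> sphere G k y n}. f z)"
    by (rule sum.swap_restrict) (auto simp: B_def fin)
  also have "\<dots> = (\<Sum>z\<in>B. of_nat (w z) * f z)" by (simp add: w_def)
  also have "\<dots> = (\<Sum>z\<in>?S (Suc n). of_nat (w z) * f z) + ((\<Sum>z\<in>?S n. of_nat (w z) * f z) +
      (\<Sum>z\<in>?S (n - 1). of_nat (w z) * f z))"
  proof -
    have "?S (Suc n) \<inter> ?S n = {}" "?S (Suc n) \<inter> ?S (n - 1) = {}" "?S n \<inter> ?S (n - 1) = {}"
      by (rule disj; use n in simp)+
    then show ?thesis using fin by (simp add: B_def sum.union_disjoint Int_Un_distrib)
  qed
  also have "(\<Sum>z\<in>?S (Suc n). of_nat (w z) * f z) = sphere_sum (Suc n) f x"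
    using card_neighbours_in_sphere[OF r _ n] by (simp add: w_def sphere_sum_def)
  also have "(\<Sum>z\<in>?S n. of_nat (w z) * f z) = of_nat (k - 2) * sphere_sum n f x"
    using card_neighbours_in_sphere[OF r _ n] by (simp add: w_def sphere_sum_def sum_distrib_left)
  also have "(\<Sum>z\<in>?S (n - 1). of_nat (w z) * f z) = of_nat ?c * sphere_sum (n - 1) f x"
  proof -
    have "w z = ?c" if "z \<in> ?S (n - 1)" for z
      using card_neighbours_in_sphere[OF r that n] n by (cases n) (simp_all add: w_def)
    then show ?thesis by (simp add: sphere_sum_def sum_distrib_left del: of_nat_mult)
  qed
  finally show ?thesis by (simp only: add.assoc)
qed

text \<open>The recurrence solved for its top term. The coefficients are fixed before
  \<open>f\<close> and \<open>x\<close>, so it can be used beneath another sphere sum.\<close>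

lemma sphere_sum_Suc_Suc:
  assumes "r > 0"
  obtains \<alpha> \<beta> where "\<And>f x. x \<in> pverts G \<Longrightarrow> sphere_sum (Suc (Suc n)) f x =
    sphere_sum 1 (sphere_sum (Suc n) f) x - \<alpha> * sphere_sum (Suc n) f x - \<beta> * sphere_sum n f x"
proof (rule that)
  fix f x assume "x \<in> pverts G"
  from sphere_sum_recurrence[OF assms this, of "Suc n" f]
  show "sphere_sum (Suc (Suc n)) f x =
    sphere_sum 1 (sphere_sum (Suc n) f) x - of_nat (k - 2) * sphere_sum (Suc n) f x -
    of_nat ((if Suc n = 1 then r else r - 1) * (k - 1)) * sphere_sum n f x"
    by (simp del: of_nat_mult)
qed

lemma sphere_sum_0: "x \<in> pverts G \<Longrightarrow> sphere_sum 0 f x = f x"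
  by (simp add: sphere_sum_def sphere_0)

lemma sphere_sum_cong:
  "(\<And>z. z \<in> pverts G \<Longrightarrow> f z = g z) \<Longrightarrow> sphere_sum n f x = sphere_sum n g x"
  using sphere_subset_pverts by (auto simp: sphere_sum_def intro!: sum.cong)

lemma sphere_sum_linear:
  "sphere_sum n (\<lambda>z. f z - \<alpha> * g z - \<beta> * h z) x =
   sphere_sum n f x - \<alpha> * sphere_sum n g x - \<beta> * sphere_sum n h x"
  by (simp add: sphere_sum_def sum_subtractf sum_distrib_left)

text \<open>Two-step induction: the recurrence builds each sphere sum from the two before it and
  \<open>sphere_sum 1\<close>.\<close>

lemma sphere_sum_commute_1:
  assumes "r > 0" "x \<in> pverts G"
  shows "sphere_sum n (sphere_sum 1 f) x = sphere_sum 1 (sphere_sum n f) x"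
  using assms(2)
proof (induction n arbitrary: x rule: induct_nat_012)
  case 0
  then show ?case using sphere_sum_0 by (simp cong: sphere_sum_cong)
next
  case 1
  then show ?case by simp
next
  case (ge2 n)
  obtain \<alpha> \<beta> where rec: "\<And>f x. x \<in> pverts G \<Longrightarrow> sphere_sum (Suc (Suc n)) f x =
    sphere_sum 1 (sphere_sum (Suc n) f) x - \<alpha> * sphere_sum (Suc n) f x - \<beta> * sphere_sum n f x"
    using sphere_sum_Suc_Suc[OF assms(1)] by blast
  have "sphere_sum 1 (sphere_sum (Suc (Suc n)) f) x = sphere_sum 1 (\<lambda>z.
    sphere_sum 1 (sphere_sum (Suc n) f) z - \<alpha> * sphere_sum (Suc n) f z - \<beta> * sphere_sum n f z) x"
    by (rule sphere_sum_cong) (rule rec)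
  also have "\<dots> = sphere_sum 1 (sphere_sum 1 (sphere_sum (Suc n) f)) x -
      \<alpha> * sphere_sum 1 (sphere_sum (Suc n) f) x - \<beta> * sphere_sum 1 (sphere_sum n f) x"
    by (rule sphere_sum_linear)
  also have "sphere_sum 1 (sphere_sum 1 (sphere_sum (Suc n) f)) x =
      sphere_sum 1 (sphere_sum (Suc n) (sphere_sum 1 f)) x"
    by (rule sphere_sum_cong) (simp add: ge2.IH del: One_nat_def)
  finally show ?case using rec[OF ge2.prems] ge2.IH ge2.prems by (simp del: One_nat_def)
qed

lemma sphere_sum_commute:
  assumes "r > 0" "x \<in> pverts G"
  shows "sphere_sum m (sphere_sum n f) x = sphere_sum n (sphere_sum m f) x"
  using assms(2)
proof (induction m arbitrary: x rule: induct_nat_012)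
  case 0
  then show ?case using sphere_sum_0 by (simp cong: sphere_sum_cong)
next
  case 1
  then show ?case using sphere_sum_commute_1 assms(1) by simp
next
  case (ge2 m)
  obtain \<alpha> \<beta> where rec: "\<And>f x. x \<in> pverts G \<Longrightarrow> sphere_sum (Suc (Suc m)) f x =
    sphere_sum 1 (sphere_sum (Suc m) f) x - \<alpha> * sphere_sum (Suc m) f x - \<beta> * sphere_sum m f x"
    using sphere_sum_Suc_Suc[OF assms(1)] by blast
  have "sphere_sum n (sphere_sum (Suc (Suc m)) f) x = sphere_sum n (\<lambda>z.
    sphere_sum 1 (sphere_sum (Suc m) f) z - \<alpha> * sphere_sum (Suc m) f z - \<beta> * sphere_sum m f z) x"
    by (rule sphere_sum_cong) (rule rec)
  also have "\<dots> = sphere_sum n (sphere_sum 1 (sphere_sum (Suc m) f)) x -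
      \<alpha> * sphere_sum n (sphere_sum (Suc m) f) x - \<beta> * sphere_sum n (sphere_sum m f) x"
    by (rule sphere_sum_linear)
  also have "sphere_sum n (sphere_sum 1 (sphere_sum (Suc m) f)) x =
      sphere_sum 1 (sphere_sum n (sphere_sum (Suc m) f)) x"
    using sphere_sum_commute_1 assms(1) ge2.prems by blast
  also have "\<dots> = sphere_sum 1 (sphere_sum (Suc m) (sphere_sum n f)) x"
    by (rule sphere_sum_cong) (simp add: ge2.IH del: One_nat_def)
  finally show ?case using rec[OF ge2.prems] ge2.IH ge2.prems by (simp del: One_nat_def)
qed

lemma sphere_sum_swap:
  "sphere_sum m (\<lambda>a. sphere_sum n (U a) y) x = sphere_sum n (\<lambda>b. sphere_sum m (\<lambda>a. U a b) x) y"
  unfolding sphere_sum_def by (rule sum.swap)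

text \<open>Induction along the recurrence, with \<open>x\<close> and \<open>y\<close> arbitrary
  because the hypothesis is needed at the neighbours of \<open>x\<close>. The composed term passes
  to the second variable by swapping sums, using \<open>U\<close>, and commuting with
  \<open>sphere_sum 1\<close>.\<close>

lemma sphere_sum_exchange:
  assumes r: "r > 0"
    and U: "\<And>x y. x \<in> pverts G \<Longrightarrow> y \<in> pverts G \<Longrightarrow>
      sphere_sum 1 (\<lambda>a. U a y) x = sphere_sum 1 (U x) y"
    and xy: "x \<in> pverts G" "y \<in> pverts G"
  shows "sphere_sum n (\<lambda>a. U a y) x = sphere_sum n (U x) y"
  using xy
proof (induction n arbitrary: x y rule: induct_nat_012)
  case 0
  then show ?case by (simp add: sphere_sum_0)
next
  case 1
  then show ?case using U by simp
next
  case (ge2 n)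
  obtain \<alpha> \<beta> where rec: "\<And>f x. x \<in> pverts G \<Longrightarrow> sphere_sum (Suc (Suc n)) f x =
    sphere_sum 1 (sphere_sum (Suc n) f) x - \<alpha> * sphere_sum (Suc n) f x - \<beta> * sphere_sum n f x"
    using sphere_sum_Suc_Suc[OF r] by blast
  have "sphere_sum 1 (sphere_sum (Suc n) (\<lambda>a. U a y)) x =
      sphere_sum 1 (\<lambda>a. sphere_sum (Suc n) (U a) y) x"
    by (rule sphere_sum_cong) (simp add: ge2 del: One_nat_def)
  also have "\<dots> = sphere_sum (Suc n) (\<lambda>b. sphere_sum 1 (\<lambda>a. U a b) x) y"
    by (rule sphere_sum_swap)
  also have "\<dots> = sphere_sum (Suc n) (sphere_sum 1 (U x)) y"
    by (rule sphere_sum_cong) (simp only: U ge2.prems)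
  also have "\<dots> = sphere_sum 1 (sphere_sum (Suc n) (U x)) y"
    using sphere_sum_commute_1 r ge2.prems(2) by blast
  finally show ?case using rec ge2 by (simp del: One_nat_def)
qed

end

theorem theorem4p1:
  fixes G :: "'a pair_pre_digraph" and k r :: nat and U :: "'a \<Rightarrow> 'a \<Rightarrow> complex"
  assumes "k \<ge> 2" and "r \<ge> 2"
    and "symmetric_graph G k r"
    and "\<And>x y. \<lbrakk>x \<in> pverts G; y \<in> pverts G\<rbrakk> \<Longrightarrow>
           laplacian G k r (\<lambda>x'. U x' y) x = laplacian G k r (\<lambda>y'. U x y') y"
  shows "(\<forall>x \<in> pverts G. \<forall>y \<in> pverts G. \<forall>m n :: nat.
            (\<Sum>x' \<in> sphere G k x m. \<Sum>y' \<in> sphere G k y n. U x' y') =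
            (\<Sum>x' \<in> sphere G k x n. \<Sum>y' \<in> sphere G k y m. U x' y')) \<and>
         (\<forall>x \<in> pverts G. \<forall>y \<in> pverts G. \<forall>n :: nat.
            (\<Sum>x' \<in> sphere G k x n. U x' y) = (\<Sum>y' \<in> sphere G k y n. U x y'))"
proof -
  interpret symmetric_graph G k r by fact
  have r: "r > 0" using assms(2) by simp
  \<comment> \<open>The term \<open>U x y\<close> and the nonzero factor cancel from the Laplacian
    identity, leaving the exchange of \<open>sphere_sum 1\<close>.\<close>
  have "(of_nat (r * (k - 1)) :: complex) \<noteq> 0" using assms(1,2) by auto
  then have "sphere_sum 1 (\<lambda>a. U a y) x = sphere_sum 1 (U x) y"
    if "x \<in> pverts G" "y \<in> pverts G" for x y
    using assms(4)[OF that] by (auto simp: laplacian_def sphere_sum_def simp del: of_nat_mult)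
  note exchange = sphere_sum_exchange[OF r this]
  have "sphere_sum m (\<lambda>a. sphere_sum n (U a) y) x = sphere_sum n (\<lambda>a. sphere_sum m (U a) y) x"
    if xy: "x \<in> pverts G" "y \<in> pverts G" for x y m n
  proof -
    \<comment> \<open>Moving the inner sum to the first variable turns the double sum into a
      composition of two commuting operators.\<close>
    have "sphere_sum i (\<lambda>a. sphere_sum j (U a) y) x =
        sphere_sum i (sphere_sum j (\<lambda>a. U a y)) x" for i j
      by (rule sphere_sum_cong) (simp add: exchange xy)
    then show ?thesis using sphere_sum_commute[OF r xy(1)] by simp
  qed
  with exchange show ?thesis by (auto simp: sphere_sum_def)
qed

end
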